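(* Let $k\ge 2$ be an integer and let $a,d\in\mathbb{N}^2$ be linearly independent over $\mathbb{Q}$ such that $\{a,a+d,\ldots,a+kd\}$ is a minimal generating set of $S_{a,d,k}=\langle a,a+d,\ldots,a+kd\rangle$. Let $b\in\mathbb{N}^2$ with $b\notin S_{a,d,k}$ and such that some positive integer multiple of $b$ lies in $S_{a,d,k}$. Let $\mu$ be the smallest positive integer such that $\mu b\in S_{a,d,k}$, and suppose that $\mu b=\sum_{i=1}^{k+1}\lambda_i(a+(i-1)d)$ with $\lambda_i\in\mathbb{N}$ such that $\lambda_1$ or $\lambda_{k+1}$ is non-zero. Let $S_{a,d,k}^b=\langle a,a+d,\ldots,a+kd,b\rangle$ and $E=\{a,a+kd\}$. Then $$\mathrm{Ap}(S_{a,d,k}^b,E)=\{(0,0)\}\cup\{b,2b,\ldots,(\mu-1)b\}\cup\{(a+id)+\ell b\mid 1\le i\le k-1,\ 0\le\ell\le\mu-1\}.$$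
   Context: $\mathbb{N}$ denotes the set of non-negative integers. $\langle a_1,\ldots,a_n\rangle=\{\sum_i\lambda_i a_i\mid \lambda_i\in\mathbb{N}\}$ is the affine semigroup generated by $a_1,\ldots,a_n\in\mathbb{N}^r$. For an affine semigroup $S$ and a set $E$ of nonzero elements of $S$, the Apery set is $\mathrm{Ap}(S,E)=\{s\in S\mid s-e\notin S\text{ for all }e\in E\}$. *)

theory Defs
  imports "HOL-Analysis.Analysis"
begin

(* Elements of N^r are the integer vectors with all components in N, so that the
   difference s - e in the Apery set is the honest one in Z^r (no truncation). *)
definition nat_vecs :: "(int ^ 'r) set" where
  "nat_vecs = {v. \<forall>i. v $ i \<in> \<nat>}"

definition nat_scale :: "nat \<Rightarrow> int ^ 'r \<Rightarrow> int ^ 'r" (infixr "\<cdot>\<^sub>N" 75) where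
  "n \<cdot>\<^sub>N v = of_nat n *s v"

(* Meant for finite G only: sums over infinite sets are 0 by convention. *)
definition affine_semigroup :: "(int ^ 'r) set \<Rightarrow> (int ^ 'r) set" where
  "affine_semigroup G = {\<Sum>g\<in>G. c g \<cdot>\<^sub>N g | c. True}"

definition minimal_generating_set :: "(int ^ 'r) set \<Rightarrow> (int ^ 'r) set \<Rightarrow> bool" where
  "minimal_generating_set G S \<longleftrightarrow>
     affine_semigroup G = S \<and> (\<forall>H. H \<subset> G \<longrightarrow> affine_semigroup H \<noteq> S)"

definition Apery :: "(int ^ 'r) set \<Rightarrow> (int ^ 'r) set \<Rightarrow> (int ^ 'r) set" where
  "Apery S E = {s \<in> S. \<forall>e\<in>E. s - e \<notin> S}"

definition rat_vec :: "int ^ 'r \<Rightarrow> rat ^ 'r" where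
  "rat_vec v = (\<chi> i. of_int (v $ i))"

(* Independence of the family (u, v); the set {u, v} collapses when u = v. *)
definition lin_indep_pair_over_rat :: "int ^ 'r \<Rightarrow> int ^ 'r \<Rightarrow> bool" where
  "lin_indep_pair_over_rat u v \<longleftrightarrow> u \<noteq> v \<and> vec.independent {rat_vec u, rat_vec v}"

definition arith_gens :: "int ^ 'r \<Rightarrow> int ^ 'r \<Rightarrow> nat \<Rightarrow> (int ^ 'r) set" where
  "arith_gens a d k = {a + i \<cdot>\<^sub>N d | i. i \<le> k}"

end

theory Submission
  imports Defs
begin

text \<open>
  Since \<open>a\<close> and \<open>d\<close> are independent, the elements of \<open>S = \<langle>a, a + d, \<dots>, a + k d\<rangle>\<close> have unique
  coordinates: they are the vectors \<open>n a + m d\<close> with \<open>0 \<le> m \<le> n k\<close>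
  (\<open>affine_semigroup_arith_gens\<close>).  Thus \<open>S\<close> is the set of lattice points, for the lattice spanned
  by \<open>a\<close> and \<open>d\<close>, of a cone, and hence it is normal: an element of the group generated by \<open>S\<close> with
  a positive multiple in \<open>S\<close> lies in \<open>S\<close> (\<open>normal_arith_gens\<close>).

  Normality makes \<open>\<mu>\<close> the order of \<open>b\<close> modulo the group generated by \<open>S\<close>: if \<open>j b\<close> is in that group
  and \<open>j > 0\<close>, then \<open>\<mu> (j b) = j (\<mu> b)\<close> is in \<open>S\<close>, so \<open>j b\<close> is in \<open>S\<close> and \<open>j \<ge> \<mu>\<close>.  Every element
  of \<open>\<langle>S, b\<rangle>\<close> is therefore \<open>s + l b\<close> for exactly one \<open>s \<in> S\<close> and one \<open>l < \<mu>\<close>, and subtracting an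
  element of \<open>S\<close> does not affect \<open>l\<close>.  So the Apery set of \<open>\<langle>S, b\<rangle>\<close> consists of the translates by
  \<open>l b\<close>, \<open>l < \<mu>\<close>, of the Apery set of \<open>S\<close> (\<open>Apery_adjoin\<close>).  The latter is read off from the
  coordinates: it is \<open>0\<close> together with the inner generators (\<open>Apery_arith_gens\<close>).
\<close>

lemma nat_scale_simps [simp]:
  "0 \<cdot>\<^sub>N v = 0" "n \<cdot>\<^sub>N 0 = 0" "Suc 0 \<cdot>\<^sub>N v = v"
  by (simp_all add: nat_scale_def)

lemma nat_scale_add_left: "(m + n) \<cdot>\<^sub>N v = m \<cdot>\<^sub>N v + n \<cdot>\<^sub>N v"
  by (simp add: nat_scale_def vector_sadd_rdistrib)

lemma nat_scale_add_right: "n \<cdot>\<^sub>N (u + v) = n \<cdot>\<^sub>N u + n \<cdot>\<^sub>N v"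
  by (simp add: nat_scale_def vector_add_ldistrib)

lemma nat_scale_nat_scale: "m \<cdot>\<^sub>N n \<cdot>\<^sub>N v = (m * n) \<cdot>\<^sub>N v"
  by (simp add: nat_scale_def vector_smult_assoc)

lemma nat_scale_diff_left: "n \<le> m \<Longrightarrow> (m - n) \<cdot>\<^sub>N v = m \<cdot>\<^sub>N v - n \<cdot>\<^sub>N v"
  by (metis add_diff_cancel_right' le_add_diff_inverse2 nat_scale_add_left)


section \<open>Affine semigroups\<close>

lemma zero_in_affine_semigroup: "0 \<in> affine_semigroup G"
  unfolding affine_semigroup_def by (auto intro!: exI[of _ "\<lambda>_. 0"])

lemma add_in_affine_semigroup:
  assumes "x \<in> affine_semigroup G" "y \<in> affine_semigroup G"
  shows "x + y \<in> affine_semigroup G"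
proof -
  from assms obtain c c' where
    "x = (\<Sum>g\<in>G. c g \<cdot>\<^sub>N g)" "y = (\<Sum>g\<in>G. c' g \<cdot>\<^sub>N g)"
    unfolding affine_semigroup_def by blast
  then have "x + y = (\<Sum>g\<in>G. (c g + c' g) \<cdot>\<^sub>N g)"
    by (simp add: nat_scale_add_left sum.distrib)
  then show ?thesis unfolding affine_semigroup_def
    by (auto intro!: exI[of _ "\<lambda>g. c g + c' g"])
qed

lemma generator_in_affine_semigroup:
  assumes "finite G" "g \<in> G"
  shows "g \<in> affine_semigroup G"
proof -
  have "(\<Sum>h\<in>G. (if h = g then Suc 0 else 0) \<cdot>\<^sub>N h) = (\<Sum>h\<in>G. if h = g then h else 0)"
    by (rule sum.cong) auto
  also have "\<dots> = g" using assms by simp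
  finally show ?thesis unfolding affine_semigroup_def
    by (auto intro!: exI[of _ "\<lambda>h. if h = g then Suc 0 else 0"])
qed

lemma nat_scale_closed:
  assumes "0 \<in> T" "\<And>x y. x \<in> T \<Longrightarrow> y \<in> T \<Longrightarrow> x + y \<in> T" "x \<in> T"
  shows "n \<cdot>\<^sub>N x \<in> T"
proof (induction n)
  case (Suc n)
  then show ?case using assms nat_scale_add_left[of 1 n x] by simp
qed (simp add: assms)

lemma nat_scale_in_affine_semigroup:
  "x \<in> affine_semigroup G \<Longrightarrow> n \<cdot>\<^sub>N x \<in> affine_semigroup G"
  by (intro nat_scale_closed zero_in_affine_semigroup add_in_affine_semigroup)

lemma affine_semigroup_least:
  assumes "G \<subseteq> T" and T: "0 \<in> T" "\<And>x y. x \<in> T \<Longrightarrow> y \<in> T \<Longrightarrow> x + y \<in> T"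
  shows "affine_semigroup G \<subseteq> T"
proof -
  have "(\<Sum>g\<in>G. c g \<cdot>\<^sub>N g) \<in> T" for c
    using \<open>G \<subseteq> T\<close>
  proof (induction G rule: infinite_finite_induct)
    case (insert g G)
    then show ?case using T nat_scale_closed[of T g "c g"] by auto
  qed (auto intro: T)
  then show ?thesis unfolding affine_semigroup_def by auto
qed

lemma affine_semigroup_adjoin:
  assumes "finite G"
  shows "affine_semigroup (G \<union> {b}) = {s + l \<cdot>\<^sub>N b | s l. s \<in> affine_semigroup G}" (is "_ = ?R")
proof
  show "affine_semigroup (G \<union> {b}) \<subseteq> ?R"
  proof (rule affine_semigroup_least)
    have "g \<in> ?R" if "g \<in> G" for g
      using generator_in_affine_semigroup[OF assms that] by (intro CollectI exI[of _ g] exI[of _ 0]) simp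
    moreover have "b \<in> ?R"
      using zero_in_affine_semigroup by (intro CollectI exI[of _ 0] exI[of _ "Suc 0"]) simp
    ultimately show "G \<union> {b} \<subseteq> ?R" by blast
    show "0 \<in> ?R"
      using zero_in_affine_semigroup by (intro CollectI exI[of _ 0]) simp
    show "x + y \<in> ?R" if xy: "x \<in> ?R" "y \<in> ?R" for x y
    proof -
      obtain s l s' l' where "s \<in> affine_semigroup G" "s' \<in> affine_semigroup G"
        "x = s + l \<cdot>\<^sub>N b" "y = s' + l' \<cdot>\<^sub>N b"
        using xy by blast
      then show ?thesis using add_in_affine_semigroup
        by (intro CollectI exI[of _ "s + s'"] exI[of _ "l + l'"]) (simp add: nat_scale_add_left)
    qed
  qed
  have "affine_semigroup G \<subseteq> affine_semigroup (G \<union> {b})"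
    using assms by (intro affine_semigroup_least zero_in_affine_semigroup add_in_affine_semigroup)
      (auto intro: generator_in_affine_semigroup)
  moreover have "l \<cdot>\<^sub>N b \<in> affine_semigroup (G \<union> {b})" for l
    using assms by (intro nat_scale_in_affine_semigroup generator_in_affine_semigroup) auto
  ultimately show "?R \<subseteq> affine_semigroup (G \<union> {b})"
    by (auto intro: add_in_affine_semigroup)
qed

text \<open>Multiples of \<open>b\<close> can be reduced modulo \<open>\<mu>\<close> because \<open>\<mu> b\<close> is absorbed by the semigroup.\<close>

lemma affine_semigroup_adjoin_reduced:
  assumes "finite G" "\<mu> > 0" "\<mu> \<cdot>\<^sub>N b \<in> affine_semigroup G"
  shows "affine_semigroup (G \<union> {b}) = {s + l \<cdot>\<^sub>N b | s l. s \<in> affine_semigroup G \<and> l < \<mu>}"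
    (is "_ = ?R")
proof
  show "affine_semigroup (G \<union> {b}) \<subseteq> ?R"
  proof
    fix x assume "x \<in> affine_semigroup (G \<union> {b})"
    then obtain s l where s: "s \<in> affine_semigroup G" and x: "x = s + l \<cdot>\<^sub>N b"
      unfolding affine_semigroup_adjoin[OF assms(1)] by blast
    have "l \<cdot>\<^sub>N b = (l div \<mu>) \<cdot>\<^sub>N \<mu> \<cdot>\<^sub>N b + (l mod \<mu>) \<cdot>\<^sub>N b"
      by (simp add: nat_scale_nat_scale flip: nat_scale_add_left)
    then have "x = (s + (l div \<mu>) \<cdot>\<^sub>N \<mu> \<cdot>\<^sub>N b) + (l mod \<mu>) \<cdot>\<^sub>N b" using x by simp
    moreover have "s + (l div \<mu>) \<cdot>\<^sub>N \<mu> \<cdot>\<^sub>N b \<in> affine_semigroup G"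
      using add_in_affine_semigroup[OF s nat_scale_in_affine_semigroup[OF assms(3)]] .
    ultimately show "x \<in> ?R" using \<open>\<mu> > 0\<close> by fastforce
  qed
next
  show "?R \<subseteq> affine_semigroup (G \<union> {b})"
    unfolding affine_semigroup_adjoin[OF assms(1)] by blast
qed


section \<open>Adjoining a generator to a normal semigroup\<close>

text \<open>For a semigroup \<open>S\<close> with zero, the differences \<open>x - y\<close> are the group that \<open>S\<close> generates.\<close>

definition normal_semigroup :: "(int ^ 'r) set \<Rightarrow> bool" where
  "normal_semigroup S \<longleftrightarrow>
     (\<forall>x\<in>S. \<forall>y\<in>S. \<forall>j>0. j \<cdot>\<^sub>N (x - y) \<in> S \<longrightarrow> x - y \<in> S)"

lemma least_multiple_le_if_multiple_in_group:
  fixes G :: "(int ^ 'r) set"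
  defines "S \<equiv> affine_semigroup G"
  assumes "normal_semigroup S"
    and "\<mu> > 0" "\<mu> \<cdot>\<^sub>N b \<in> S"
    and least: "\<And>m. m > 0 \<Longrightarrow> m \<cdot>\<^sub>N b \<in> S \<Longrightarrow> \<mu> \<le> m"
    and "x \<in> S" "y \<in> S" "j > 0" "j \<cdot>\<^sub>N b = x - y"
  shows "\<mu> \<le> j"
proof (rule least)
  have "\<mu> \<cdot>\<^sub>N (x - y) = j \<cdot>\<^sub>N \<mu> \<cdot>\<^sub>N b"
    by (simp add: \<open>j \<cdot>\<^sub>N b = x - y\<close>[symmetric] nat_scale_nat_scale mult.commute)
  also have "\<dots> \<in> S"
    using \<open>\<mu> \<cdot>\<^sub>N b \<in> S\<close> unfolding S_def by (rule nat_scale_in_affine_semigroup)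
  finally show "j \<cdot>\<^sub>N b \<in> S"
    using assms unfolding normal_semigroup_def by metis
qed fact

text \<open>
  If \<open>s + l b - e = s' + l' b\<close> with \<open>l, l' < \<mu>\<close>, then \<open>(l - l') b\<close> lies in the group generated by
  \<open>S\<close>, which forces \<open>l = l'\<close>; so \<open>s + l b - e\<close> is in the enlarged semigroup only if \<open>s - e\<close> is in \<open>S\<close>.
\<close>

lemma Apery_adjoin:
  fixes G :: "(int ^ 'r) set"
  defines "S \<equiv> affine_semigroup G"
  assumes "finite G" and normal: "normal_semigroup S" and "E \<subseteq> S"
    and \<mu>: "\<mu> > 0" "\<mu> \<cdot>\<^sub>N b \<in> S"
    and least: "\<And>m. m > 0 \<Longrightarrow> m \<cdot>\<^sub>N b \<in> S \<Longrightarrow> \<mu> \<le> m"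
  shows "Apery (affine_semigroup (G \<union> {b})) E = {s + l \<cdot>\<^sub>N b | s l. s \<in> Apery S E \<and> l < \<mu>}"
proof -
  have Sb: "affine_semigroup (G \<union> {b}) = {s + l \<cdot>\<^sub>N b | s l. s \<in> S \<and> l < \<mu>}"
    unfolding S_def using \<open>finite G\<close> \<mu>[unfolded S_def] by (rule affine_semigroup_adjoin_reduced)
  have add: "x + y \<in> S" if "x \<in> S" "y \<in> S" for x y
    using that unfolding S_def by (rule add_in_affine_semigroup)
  note order = least_multiple_le_if_multiple_in_group
    [OF normal[unfolded S_def] \<mu>[unfolded S_def] least[unfolded S_def], folded S_def]
  have shift: "s + l \<cdot>\<^sub>N b - e \<in> affine_semigroup (G \<union> {b}) \<longleftrightarrow> s - e \<in> S"
    if s: "s \<in> S" and e: "e \<in> S" and l: "l < \<mu>" for s e l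
  proof
    assume "s + l \<cdot>\<^sub>N b - e \<in> affine_semigroup (G \<union> {b})"
    then obtain s' l' where s': "s' \<in> S" "l' < \<mu>" and eq: "s + l \<cdot>\<^sub>N b - e = s' + l' \<cdot>\<^sub>N b"
      unfolding Sb by blast
    have "\<not> l < l'"
    proof
      assume "l < l'"
      then have "(l' - l) \<cdot>\<^sub>N b = s - (s' + e)"
        using eq by (simp add: nat_scale_diff_left algebra_simps)
      then have "\<mu> \<le> l' - l" using \<open>l < l'\<close> s e s' add by (intro order) auto
      then show False using s' \<open>l < l'\<close> by simp
    qed
    moreover have "\<not> l' < l"
    proof
      assume "l' < l"
      then have "(l - l') \<cdot>\<^sub>N b = (s' + e) - s"
        using eq by (simp add: nat_scale_diff_left algebra_simps)
      then have "\<mu> \<le> l - l'" using \<open>l' < l\<close> s e s' add by (intro order) auto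
      then show False using l \<open>l' < l\<close> by simp
    qed
    ultimately have "l = l'" by simp
    then have "s - e = s'" using eq by (simp add: algebra_simps)
    then show "s - e \<in> S" using s' by simp
  next
    assume "s - e \<in> S"
    then show "s + l \<cdot>\<^sub>N b - e \<in> affine_semigroup (G \<union> {b})"
      unfolding Sb using l by (intro CollectI exI[of _ "s - e"] exI[of _ l]) simp
  qed
  show ?thesis
  proof (intro set_eqI iffI)
    fix x assume x: "x \<in> Apery (affine_semigroup (G \<union> {b})) E"
    then obtain s l where "s \<in> S" "l < \<mu>" "x = s + l \<cdot>\<^sub>N b"
      unfolding Apery_def Sb by blast
    then show "x \<in> {s + l \<cdot>\<^sub>N b | s l. s \<in> Apery S E \<and> l < \<mu>}"
      using x shift \<open>E \<subseteq> S\<close> unfolding Apery_def by blast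
  next
    fix x assume "x \<in> {s + l \<cdot>\<^sub>N b | s l. s \<in> Apery S E \<and> l < \<mu>}"
    then obtain s l where s: "s \<in> S" "\<forall>e\<in>E. s - e \<notin> S" "l < \<mu>" "x = s + l \<cdot>\<^sub>N b"
      unfolding Apery_def by blast
    then have "x \<in> affine_semigroup (G \<union> {b})" unfolding Sb by blast
    then show "x \<in> Apery (affine_semigroup (G \<union> {b})) E"
      using s shift \<open>E \<subseteq> S\<close> unfolding Apery_def by blast
  qed
qed


section \<open>Semigroups generated by an arithmetic sequence\<close>

lemma finite_arith_gens: "finite (arith_gens a d k)"
proof -
  have "arith_gens a d k = (\<lambda>i. a + i \<cdot>\<^sub>N d) ` {..k}"
    unfolding arith_gens_def by auto
  then show ?thesis by simp
qed

lemma affine_semigroup_arith_gens: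
  "affine_semigroup (arith_gens a d k) = {n \<cdot>\<^sub>N a + m \<cdot>\<^sub>N d | n m. m \<le> n * k}" (is "?S = ?R")
proof
  show "?S \<subseteq> ?R"
  proof (rule affine_semigroup_least)
    show "arith_gens a d k \<subseteq> ?R"
    proof
      fix x assume "x \<in> arith_gens a d k"
      then obtain i where "i \<le> k" "x = a + i \<cdot>\<^sub>N d" unfolding arith_gens_def by blast
      then show "x \<in> ?R" by (intro CollectI exI[of _ "Suc 0"] exI[of _ i]) simp
    qed
    show "0 \<in> ?R" by (intro CollectI exI[of _ 0]) simp
    show "x + y \<in> ?R" if xy: "x \<in> ?R" "y \<in> ?R" for x y
    proof -
      obtain n m n' m' where "x = n \<cdot>\<^sub>N a + m \<cdot>\<^sub>N d" "m \<le> n * k" "y = n' \<cdot>\<^sub>N a + m' \<cdot>\<^sub>N d" "m' \<le> n' * k"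
        using xy by blast
      then show ?thesis
        by (intro CollectI exI[of _ "n + n'"] exI[of _ "m + m'"])
          (simp add: nat_scale_add_left algebra_simps)
    qed
  qed
  have "n \<cdot>\<^sub>N a + m \<cdot>\<^sub>N d \<in> ?S" if "m \<le> n * k" for n m
    using that
  proof (induction n arbitrary: m)
    case 0
    then show ?case by (simp add: zero_in_affine_semigroup)
  next
    case (Suc n)
    \<comment> \<open>Split off the generator with the largest multiple of \<open>d\<close> that fits.\<close>
    define i where "i = min m k"
    have "a + i \<cdot>\<^sub>N d \<in> ?S"
      by (rule generator_in_affine_semigroup[OF finite_arith_gens])
        (auto simp: arith_gens_def i_def)
    moreover have "n \<cdot>\<^sub>N a + (m - i) \<cdot>\<^sub>N d \<in> ?S"
      using Suc.prems by (intro Suc.IH) (auto simp: i_def)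
    ultimately have "(a + i \<cdot>\<^sub>N d) + (n \<cdot>\<^sub>N a + (m - i) \<cdot>\<^sub>N d) \<in> ?S"
      by (rule add_in_affine_semigroup)
    moreover have "Suc n \<cdot>\<^sub>N a = a + n \<cdot>\<^sub>N a" using nat_scale_add_left[of 1 n a] by simp
    moreover have "m \<cdot>\<^sub>N d = i \<cdot>\<^sub>N d + (m - i) \<cdot>\<^sub>N d"
      by (simp add: i_def flip: nat_scale_add_left)
    ultimately show ?case by (simp add: algebra_simps)
  qed
  then show "?R \<subseteq> ?S" by blast
qed

lemma lin_indep_pair_int_coords_zero:
  assumes "lin_indep_pair_over_rat a d" and eq: "p *s a + q *s d = 0"
  shows "p = 0 \<and> q = 0"
proof -
  have ne: "rat_vec a \<noteq> rat_vec d"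
    using assms(1) by (auto simp: lin_indep_pair_over_rat_def rat_vec_def vec_eq_iff)
  have ind: "vec.independent {rat_vec a, rat_vec d}"
    using assms(1) by (simp add: lin_indep_pair_over_rat_def)
  let ?u = "\<lambda>v. if v = rat_vec a then rat_of_int p else rat_of_int q"
  have "rat_of_int p * of_int (a $ i) + rat_of_int q * of_int (d $ i) = 0" for i
    using arg_cong[OF eq, of "\<lambda>v. rat_of_int (v $ i)"] by simp
  then have "rat_of_int p *s rat_vec a + rat_of_int q *s rat_vec d = 0"
    by (simp add: vec_eq_iff rat_vec_def)
  then have comb: "(\<Sum>v\<in>{rat_vec a, rat_vec d}. ?u v *s v) = 0"
    using ne by simp
  have indep: "(\<Sum>v\<in>{rat_vec a, rat_vec d}. u v *s v) = 0 \<Longrightarrow>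
      \<forall>v\<in>{rat_vec a, rat_vec d}. u v = 0" for u
    using ind unfolding vec.independent_explicit_finite_subsets
    by (meson finite.emptyI finite.insertI order_refl)
  show ?thesis using indep[OF comb] ne by auto
qed

lemma lin_indep_pair_int_coords_unique:
  assumes "lin_indep_pair_over_rat a d" "p *s a + q *s d = p' *s a + q' *s d"
  shows "p = p' \<and> q = q'"
proof -
  have "(p - p') *s a + (q - q') *s d = 0"
    using assms(2) by (simp add: vector_sub_rdistrib algebra_simps)
  then show ?thesis using lin_indep_pair_int_coords_zero[OF assms(1)] by fastforce
qed

text \<open>
  With unique coordinates, membership of a lattice vector becomes the pair of inequalities that
  defines the cone.  The coordinates are integers because differences of elements of the semigroup
  are tested as well; \<open>k > 0\<close> is what makes \<open>0 \<le> q \<le> p k\<close> imply \<open>p \<ge> 0\<close>.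
\<close>

lemma lattice_vec_in_affine_semigroup_arith_gens_iff:
  assumes "lin_indep_pair_over_rat a d" "k > 0"
  shows "p *s a + q *s d \<in> affine_semigroup (arith_gens a d k) \<longleftrightarrow> 0 \<le> q \<and> q \<le> p * int k"
proof
  assume "p *s a + q *s d \<in> affine_semigroup (arith_gens a d k)"
  then obtain n m where "m \<le> n * k" "p *s a + q *s d = int n *s a + int m *s d"
    unfolding affine_semigroup_arith_gens nat_scale_def by auto
  then have "p = int n" "q = int m" "m \<le> n * k"
    using lin_indep_pair_int_coords_unique[OF assms(1)] by blast+
  then show "0 \<le> q \<and> q \<le> p * int k" by (simp flip: of_nat_mult)
next
  assume r: "0 \<le> q \<and> q \<le> p * int k"
  then have "0 \<le> p * int k" by linarith
  then have p: "0 \<le> p" using \<open>k > 0\<close> by (simp add: zero_le_mult_iff)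
  have "int (nat q) \<le> int (nat p * k)" using r p by simp
  then have "nat q \<le> nat p * k" by (simp only: of_nat_le_iff)
  moreover have "p *s a + q *s d = nat p \<cdot>\<^sub>N a + nat q \<cdot>\<^sub>N d"
    using p r by (simp add: nat_scale_def)
  ultimately show "p *s a + q *s d \<in> affine_semigroup (arith_gens a d k)"
    unfolding affine_semigroup_arith_gens by blast
qed

lemma normal_arith_gens:
  assumes "lin_indep_pair_over_rat a d" "k > 0"
  shows "normal_semigroup (affine_semigroup (arith_gens a d k))"
  unfolding normal_semigroup_def
proof (intro ballI allI impI)
  let ?S = "affine_semigroup (arith_gens a d k)"
  note mem = lattice_vec_in_affine_semigroup_arith_gens_iff[OF assms]
  fix x y and j :: nat
  assume "x \<in> ?S" "y \<in> ?S" "j > 0" and j: "j \<cdot>\<^sub>N (x - y) \<in> ?S"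
  then obtain n m n' m' where
    "x = n \<cdot>\<^sub>N a + m \<cdot>\<^sub>N d" "y = n' \<cdot>\<^sub>N a + m' \<cdot>\<^sub>N d"
    unfolding affine_semigroup_arith_gens by blast
  then have "x - y = (int n - int n') *s a + (int m - int m') *s d"
    by (simp add: nat_scale_def vector_sub_rdistrib)
  then obtain p q where xy: "x - y = p *s a + q *s d" by blast
  have "(int j * p) *s a + (int j * q) *s d \<in> ?S"
    using j by (simp add: xy nat_scale_def vector_add_ldistrib vector_smult_assoc)
  then have "0 \<le> int j * q" "int j * q \<le> int j * (p * int k)"
    unfolding mem by (simp_all add: mult.assoc)
  then have "0 \<le> q" "q \<le> p * int k"
    using \<open>j > 0\<close> by (simp_all add: zero_le_mult_iff)
  then show "x - y \<in> ?S" unfolding xy mem by blast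
qed

text \<open>
  For \<open>s = n a + m d\<close>, not being able to subtract \<open>a\<close> means \<open>m > (n - 1) k\<close>, and not being able to
  subtract \<open>a + k d\<close> means \<open>m < k\<close>.  Together these leave room only for \<open>n \<le> 1\<close>.
\<close>

lemma Apery_arith_gens:
  assumes "lin_indep_pair_over_rat a d" "k > 0"
  shows "Apery (affine_semigroup (arith_gens a d k)) {a, a + k \<cdot>\<^sub>N d} =
    {0} \<union> {a + i \<cdot>\<^sub>N d | i. 1 \<le> i \<and> i \<le> k - 1}" (is "Apery ?S ?E = ?R")
proof -
  note mem = lattice_vec_in_affine_semigroup_arith_gens_iff[OF assms]
  have Apery_iff: "n \<cdot>\<^sub>N a + m \<cdot>\<^sub>N d \<in> Apery ?S ?E \<longleftrightarrow>
      m \<le> n * k \<and> (int n - 1) * int k < int m \<and> m < k" for n m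
  proof -
    let ?s = "n \<cdot>\<^sub>N a + m \<cdot>\<^sub>N d"
    have s: "?s = int n *s a + int m *s d"
      by (simp add: nat_scale_def)
    have minus_a: "?s - a = (int n - 1) *s a + int m *s d"
      by (simp add: nat_scale_def vector_sub_rdistrib)
    have minus_akd: "?s - (a + k \<cdot>\<^sub>N d) = (int n - 1) *s a + (int m - int k) *s d"
      by (simp add: nat_scale_def vector_sub_rdistrib)
    have "?s \<in> ?S \<longleftrightarrow> m \<le> n * k"
      unfolding s mem by (simp flip: of_nat_mult)
    moreover have "?s - a \<in> ?S \<longleftrightarrow> int m \<le> (int n - 1) * int k"
      unfolding minus_a mem by simp
    moreover have "?s - (a + k \<cdot>\<^sub>N d) \<in> ?S \<longleftrightarrow> k \<le> m \<and> m \<le> n * k"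
      unfolding minus_akd mem by (simp add: left_diff_distrib flip: of_nat_mult)
    moreover have "?s \<in> Apery ?S ?E \<longleftrightarrow> ?s \<in> ?S \<and> ?s - a \<notin> ?S \<and> ?s - (a + k \<cdot>\<^sub>N d) \<notin> ?S"
      unfolding Apery_def by blast
    ultimately show ?thesis by linarith
  qed
  show ?thesis
  proof (intro set_eqI iffI)
    fix x assume x: "x \<in> Apery ?S ?E"
    then obtain n m where xnm: "x = n \<cdot>\<^sub>N a + m \<cdot>\<^sub>N d"
      unfolding Apery_def affine_semigroup_arith_gens by blast
    then have m: "m \<le> n * k" "(int n - 1) * int k < int m" "m < k"
      using x Apery_iff by blast+
    then have "(int n - 1) * int k < 1 * int k" by linarith
    then have "int n - 1 < 1" using mult_less_cancel_right_pos[of "int k"] \<open>k > 0\<close> by simp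
    then consider "n = 0" | "n = 1" by linarith
    then show "x \<in> ?R"
    proof cases
      case 1
      then show ?thesis using xnm m by simp
    next
      case 2
      then have "x = a + m \<cdot>\<^sub>N d" "1 \<le> m" "m \<le> k - 1" using xnm m by simp_all
      then show ?thesis by blast
    qed
  next
    fix x assume "x \<in> ?R"
    then consider "x = 0" | i where "x = a + i \<cdot>\<^sub>N d" "1 \<le> i" "i \<le> k - 1" by blast
    then show "x \<in> Apery ?S ?E"
    proof cases
      case 1
      then show ?thesis using Apery_iff[of 0 0] \<open>k > 0\<close> by simp
    next
      case 2
      then show ?thesis using Apery_iff[of 1 i] \<open>k > 0\<close> by auto
    qed
  qed
qed


section \<open>The Apery set of the extended arithmetic semigroup\<close>

theorem proposition7p3:
  fixes k \<mu> :: nat and a d b :: "int ^ 2" and lam :: "nat \<Rightarrow> nat"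
  assumes "k \<ge> 2"
    and "a \<in> nat_vecs" and "d \<in> nat_vecs"
    and "lin_indep_pair_over_rat a d"
    and "minimal_generating_set (arith_gens a d k) (affine_semigroup (arith_gens a d k))"
    and "b \<in> nat_vecs"
    and "b \<notin> affine_semigroup (arith_gens a d k)"
    and "\<exists>m>0. m \<cdot>\<^sub>N b \<in> affine_semigroup (arith_gens a d k)"
    and "\<mu> = (LEAST m. m > 0 \<and> m \<cdot>\<^sub>N b \<in> affine_semigroup (arith_gens a d k))"
    and "\<mu> \<cdot>\<^sub>N b = (\<Sum>i=1..k+1. lam i \<cdot>\<^sub>N (a + (i - 1) \<cdot>\<^sub>N d))"
    and "lam 1 \<noteq> 0 \<or> lam (k + 1) \<noteq> 0"
  shows "Apery (affine_semigroup (arith_gens a d k \<union> {b})) {a, a + k \<cdot>\<^sub>N d} =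
    {0} \<union> {l \<cdot>\<^sub>N b | l. 1 \<le> l \<and> l \<le> \<mu> - 1} \<union>
    {(a + i \<cdot>\<^sub>N d) + l \<cdot>\<^sub>N b | i l. 1 \<le> i \<and> i \<le> k - 1 \<and> l \<le> \<mu> - 1}"
proof -
  define S where "S = affine_semigroup (arith_gens a d k)"
  have k: "k > 0" using assms(1) by simp
  have "\<mu> > 0 \<and> \<mu> \<cdot>\<^sub>N b \<in> S"
    using assms(8) unfolding assms(9) S_def by (rule LeastI_ex)
  then have \<mu>: "\<mu> > 0" "\<mu> \<cdot>\<^sub>N b \<in> S" by auto
  have less_iff_le: "l < \<mu> \<longleftrightarrow> l \<le> \<mu> - 1" for l using \<mu>(1) by auto
  have least: "\<mu> \<le> m" if "m > 0" "m \<cdot>\<^sub>N b \<in> S" for m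
    using that unfolding assms(9) S_def by (blast intro: Least_le)
  have "a + i \<cdot>\<^sub>N d \<in> S" if "i \<le> k" for i
    unfolding S_def using that
    by (intro generator_in_affine_semigroup finite_arith_gens) (auto simp: arith_gens_def)
  from this[of 0] this[of k] have "{a, a + k \<cdot>\<^sub>N d} \<subseteq> S" by simp
  then have "Apery (affine_semigroup (arith_gens a d k \<union> {b})) {a, a + k \<cdot>\<^sub>N d} =
      {s + l \<cdot>\<^sub>N b | s l. s \<in> Apery S {a, a + k \<cdot>\<^sub>N d} \<and> l < \<mu>}"
    using Apery_adjoin[OF finite_arith_gens normal_arith_gens[OF assms(4) k]] \<mu> least
    unfolding S_def by blast
  also have "\<dots> = {l \<cdot>\<^sub>N b | l. l < \<mu>} \<union>
      {(a + i \<cdot>\<^sub>N d) + l \<cdot>\<^sub>N b | i l. 1 \<le> i \<and> i \<le> k - 1 \<and> l < \<mu>}"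
    unfolding S_def Apery_arith_gens[OF assms(4) k] by force
  also have "{l \<cdot>\<^sub>N b | l. l < \<mu>} = {0} \<union> {l \<cdot>\<^sub>N b | l. 1 \<le> l \<and> l \<le> \<mu> - 1}"
  proof -
    have less_iff: "l < \<mu> \<longleftrightarrow> l = 0 \<or> 1 \<le> l \<and> l \<le> \<mu> - 1" for l
      using \<mu>(1) by auto
    show ?thesis unfolding less_iff by (auto intro: exI[of _ 0])
  qed
  finally show ?thesis by (simp only: less_iff_le)
qed

end
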